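(* Let $\mathcal{G}=(V,E)$ be a hypergraph with $|V|=n$ in which every hyperedge contains at most $f$ nodes. Let $\beta = 17$, $\alpha = 1+36 f^2\beta^2$, $L=\lceil f\log_\beta n\rceil+1$, and let $\ell: V\to\{0,1,\ldots,L\}$ be any level assignment. For a hyperedge $e$ put $\ell(e)=\max_{v\in e}\ell(v)$ and $w(e)=\beta^{-\ell(e)}$, and for a node $v$ put $W_v=\sum_{e\in E: v\in e} w(e)$. Suppose that every node $v$ with $\ell(v)>0$ satisfies $1/(\alpha\beta^2) < W_v < 1$, and every node $v$ with $\ell(v)=0$ satisfies $0\le W_v\le 1/\beta^2$. Then the weights $\{w(e)\}_{e\in E}$ form an $f\alpha\beta^2$-approximate maximum fractional matching of $\mathcal{G}$, and the set of nodes $\{v: \ell(v)\in\{1,\ldots,L\}\}$ forms an $f\alpha\beta^2$-approximate minimum vertex cover of $\mathcal{G}$.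
   Context: A fractional matching assigns weights $w(e)\ge 0$ to hyperedges with $\sum_{e\ni v} w(e)\le 1$ for every node $v$; its size is $\sum_e w(e)$. A $c$-approximate maximum fractional matching has size at least $1/c$ times the maximum fractional matching size; a $c$-approximate minimum vertex cover is a vertex cover (set of nodes meeting every hyperedge) of size at most $c$ times the minimum. *)

theory Defs
  imports Complex_Main
begin

(* Hyperedges are required to be nonempty: an empty one could not be met by any vertex cover,
   would make the fractional matching size unbounded, and has no level. *)
definition hypergraph :: "'a set \<Rightarrow> 'a set set \<Rightarrow> bool" where
  "hypergraph V E \<longleftrightarrow> finite V \<and> (\<forall>e\<in>E. e \<subseteq> V \<and> e \<noteq> {})"

definition node_weight :: "'a set set \<Rightarrow> ('a set \<Rightarrow> real) \<Rightarrow> 'a \<Rightarrow> real" where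
  "node_weight E w v = (\<Sum>e | e \<in> E \<and> v \<in> e. w e)"

definition fractional_matching :: "'a set \<Rightarrow> 'a set set \<Rightarrow> ('a set \<Rightarrow> real) \<Rightarrow> bool" where
  "fractional_matching V E w \<longleftrightarrow>
     (\<forall>e\<in>E. w e \<ge> 0) \<and> (\<forall>v\<in>V. node_weight E w v \<le> 1)"

definition matching_size :: "'a set set \<Rightarrow> ('a set \<Rightarrow> real) \<Rightarrow> real" where
  "matching_size E w = (\<Sum>e\<in>E. w e)"

definition max_fractional_matching :: "'a set \<Rightarrow> 'a set set \<Rightarrow> ('a set \<Rightarrow> real) \<Rightarrow> bool" where
  "max_fractional_matching V E w \<longleftrightarrow>
     fractional_matching V E w \<and>
     (\<forall>w'. fractional_matching V E w' \<longrightarrow> matching_size E w' \<le> matching_size E w)"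

(* The existential includes the claim that a maximum is attained; its size is then unique. *)
definition approx_max_fractional_matching ::
    "real \<Rightarrow> 'a set \<Rightarrow> 'a set set \<Rightarrow> ('a set \<Rightarrow> real) \<Rightarrow> bool" where
  "approx_max_fractional_matching c V E w \<longleftrightarrow>
     fractional_matching V E w \<and>
     (\<exists>w'. max_fractional_matching V E w' \<and> matching_size E w \<ge> (1 / c) * matching_size E w')"

definition vertex_cover :: "'a set \<Rightarrow> 'a set set \<Rightarrow> 'a set \<Rightarrow> bool" where
  "vertex_cover V E C \<longleftrightarrow> C \<subseteq> V \<and> (\<forall>e\<in>E. C \<inter> e \<noteq> {})"

definition min_vertex_cover :: "'a set \<Rightarrow> 'a set set \<Rightarrow> 'a set \<Rightarrow> bool" where
  "min_vertex_cover V E C \<longleftrightarrow>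
     vertex_cover V E C \<and> (\<forall>C'. vertex_cover V E C' \<longrightarrow> card C \<le> card C')"

definition approx_min_vertex_cover :: "real \<Rightarrow> 'a set \<Rightarrow> 'a set set \<Rightarrow> 'a set \<Rightarrow> bool" where
  "approx_min_vertex_cover c V E C \<longleftrightarrow>
     vertex_cover V E C \<and>
     (\<exists>C'. min_vertex_cover V E C' \<and> real (card C) \<le> c * real (card C'))"

definition edge_level :: "('a \<Rightarrow> nat) \<Rightarrow> 'a set \<Rightarrow> nat" where
  "edge_level l e = Max (l ` e)"

definition level_weight :: "real \<Rightarrow> ('a \<Rightarrow> nat) \<Rightarrow> 'a set \<Rightarrow> real" where
  "level_weight \<beta> l e = \<beta> powi (- int (edge_level l e))"

end

(* Primal and dual are compared through the double count
   \<Sum>v\<in>C. W v = \<Sum>e\<in>E. |C \<inter> e| * w e. For a vertex cover C every |C \<inter> e| is at least 1, which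
   gives weak duality: every fractional matching has size at most |C|. For the given weights and
   C = {v. l v > 0} every |C \<inter> e| is at most f and every W v is at least 1 / (\<alpha> \<beta>^2), so
   |C| \<le> f \<alpha> \<beta>^2 * (\<Sum>e\<in>E. w e), and both ratios follow. C is a cover because an edge of level 0
   has weight 1, more than a node of level 0 may carry. *)
theory Submission
  imports Defs "HOL-Analysis.Function_Topology"
begin

lemma hypergraph_finite_edges: "hypergraph V E \<Longrightarrow> finite E"
  unfolding hypergraph_def by (meson PowI finite_Pow_iff finite_subset subsetI)

lemma sum_node_weight:
  assumes "finite E" "finite C"
  shows "(\<Sum>v\<in>C. node_weight E w v) = (\<Sum>e\<in>E. real (card (C \<inter> e)) * w e)"
proof -
  have "(\<Sum>v\<in>C. node_weight E w v) = (\<Sum>v\<in>C. \<Sum>e\<in>E. if v \<in> e then w e else 0)"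
    unfolding node_weight_def using assms by (simp add: sum.inter_filter)
  also have "\<dots> = (\<Sum>e\<in>E. \<Sum>v\<in>C. if v \<in> e then w e else 0)"
    by (rule sum.swap)
  also have "\<dots> = (\<Sum>e\<in>E. real (card (C \<inter> e)) * w e)"
    using assms by (simp flip: sum.inter_restrict)
  finally show ?thesis .
qed

lemma matching_size_le_card_vertex_cover:
  assumes H: "hypergraph V E" and M: "fractional_matching V E w" and C: "vertex_cover V E C"
  shows "matching_size E w \<le> real (card C)"
proof -
  have fin: "finite E" "finite C"
    using H C hypergraph_finite_edges by (auto simp: hypergraph_def vertex_cover_def finite_subset)
  have "w e \<le> real (card (C \<inter> e)) * w e" if "e \<in> E" for e
  proof -
    have "card (C \<inter> e) \<ge> 1"
      using C that fin by (simp add: vertex_cover_def Suc_le_eq card_gt_0_iff)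
    then show ?thesis
      using mult_right_mono[of 1 "real (card (C \<inter> e))" "w e"] M that
      by (simp add: fractional_matching_def)
  qed
  then have "matching_size E w \<le> (\<Sum>v\<in>C. node_weight E w v)"
    unfolding matching_size_def sum_node_weight[OF fin] by (rule sum_mono)
  also have "\<dots> \<le> (\<Sum>v\<in>C. 1)"
    using M C by (intro sum_mono) (auto simp: fractional_matching_def vertex_cover_def)
  finally show ?thesis by simp
qed

text \<open>Compactness argument: every edge contains a node, so its weight in a fractional matching
  lies in [0, 1]. Up to values outside \<open>E\<close>, the fractional matchings then form a closed
  part of a compact product of intervals, and the size is continuous on it.\<close>

lemma ex_max_fractional_matching:
  assumes H: "hypergraph V E"
  obtains w where "max_fractional_matching V E w"
proof -
  have fin: "finite E" using H by (rule hypergraph_finite_edges)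
  \<comment> \<open>Weights are total functions on all sets, so the coordinates outside
    \<open>E\<close> are pinned to 0; left free, they would make the product noncompact.\<close>
  define K :: "('a set \<Rightarrow> real) set" where "K = (\<Pi>\<^sub>E e\<in>UNIV. if e \<in> E then {0..1} else {0})"
  define S where "S = {w. \<forall>v\<in>V. node_weight E w v \<le> 1}"
  have "compactin (product_topology (\<lambda>_. euclidean) UNIV) K"
    unfolding K_def by (subst compactin_PiE) auto
  then have "compact K"
    by (simp add: euclidean_product_topology)
  moreover have "S = (\<Inter>v\<in>V. {w. node_weight E w v \<le> 1})"
    by (auto simp: S_def)
  then have "closed S"
    unfolding node_weight_def
    by (auto intro!: closed_INT closed_Collect_le continuous_on_sum continuous_on_product_coordinates)
  ultimately have "compact (K \<inter> S)" by (rule compact_Int_closed)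
  \<comment> \<open>The supremum is attained only on a nonempty set; the zero weighting provides a
    point.\<close>
  moreover have "(\<lambda>_. 0) \<in> K \<inter> S"
    by (auto simp: K_def S_def node_weight_def)
  moreover have "continuous_on (K \<inter> S) (matching_size E)"
    unfolding matching_size_def
    by (intro continuous_on_sum continuous_on_subset[OF continuous_on_product_coordinates]) auto
  ultimately obtain w where w: "w \<in> K \<inter> S"
    and max: "\<And>u. u \<in> K \<inter> S \<Longrightarrow> matching_size E u \<le> matching_size E w"
    using continuous_attains_sup[of "K \<inter> S" "matching_size E"] by blast
  have "0 \<le> w e" if "e \<in> E" for e
    using w that by (auto simp: K_def PiE_iff dest!: spec[of _ e])
  then have "fractional_matching V E w"
    using w by (auto simp: fractional_matching_def S_def)
  moreover have "matching_size E u \<le> matching_size E w" if u: "fractional_matching V E u" for u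
  proof -
    have "u e \<le> 1" if e: "e \<in> E" for e
    proof -
      obtain v where v: "v \<in> e" "v \<in> V"
        using H e by (auto simp: hypergraph_def)
      have "u e \<le> node_weight E u v"
        unfolding node_weight_def using fin e v u
        by (intro member_le_sum) (auto simp: fractional_matching_def)
      also have "\<dots> \<le> 1" using u v by (simp add: fractional_matching_def)
      finally show ?thesis .
    qed
    \<comment> \<open>\<open>u\<close> may take any values outside \<open>E\<close> and so miss
      \<open>K\<close>. Resetting them to 0 changes neither the node weights nor the size.\<close>
    moreover define u' where "u' e = (if e \<in> E then u e else 0)" for e
    moreover have "node_weight E u' v = node_weight E u v" for v
      unfolding node_weight_def u'_def by (rule sum.cong) auto
    ultimately have "u' \<in> K \<inter> S"
      using u by (auto simp: K_def S_def fractional_matching_def)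
    then have "matching_size E u' \<le> matching_size E w" by (rule max)
    then show ?thesis by (simp add: matching_size_def u'_def)
  qed
  ultimately show thesis
    using that by (auto simp: max_fractional_matching_def)
qed

text \<open>Cardinalities are natural numbers, so a single cover is enough for a smallest one to
  exist.\<close>

lemma ex_min_vertex_cover:
  assumes "vertex_cover V E C"
  obtains C' where "min_vertex_cover V E C'"
  using ex_has_least_nat[of "vertex_cover V E" C card] assms that
  by (auto simp: min_vertex_cover_def)

theorem theorem2:
  fixes V :: "'a set" and E :: "'a set set" and n f L :: nat
    and \<alpha> \<beta> :: real and l :: "'a \<Rightarrow> nat"
  assumes "hypergraph V E" and "card V = n"
    and "\<forall>e\<in>E. card e \<le> f"
    and "\<beta> = 17"
    and "\<alpha> = 1 + 36 * (real f)^2 * \<beta>^2"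
    and "L = nat \<lceil>real f * log \<beta> (real n)\<rceil> + 1"
    and "\<forall>v\<in>V. l v \<in> {0..L}"
    and "\<forall>v\<in>V. l v > 0 \<longrightarrow>
           1 / (\<alpha> * \<beta>^2) < node_weight E (level_weight \<beta> l) v \<and>
           node_weight E (level_weight \<beta> l) v < 1"
    and "\<forall>v\<in>V. l v = 0 \<longrightarrow>
           0 \<le> node_weight E (level_weight \<beta> l) v \<and>
           node_weight E (level_weight \<beta> l) v \<le> 1 / \<beta>^2"
  shows "approx_max_fractional_matching (real f * \<alpha> * \<beta>^2) V E (level_weight \<beta> l) \<and>
         approx_min_vertex_cover (real f * \<alpha> * \<beta>^2) V E {v \<in> V. l v \<in> {1..L}}"
proof -
  define w where "w = level_weight \<beta> l"
  define C where "C = {v \<in> V. l v \<in> {1..L}}"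
  have C_eq: "C = {v \<in> V. l v > 0}"
    using assms(7) by (auto simp: C_def)
  have fin: "finite E" "finite V" "finite C"
    using assms(1) hypergraph_finite_edges by (auto simp: hypergraph_def C_def)
  have c_pos: "\<alpha> * \<beta>\<^sup>2 > 0"
    using assms(4,5) by (simp add: add_pos_nonneg)
  have w_nonneg: "w e \<ge> 0" for e
    using assms(4) by (simp add: w_def level_weight_def)
  have matching: "fractional_matching V E w"
    unfolding fractional_matching_def
  proof (intro conjI ballI)
    fix v assume "v \<in> V"
    then show "node_weight E w v \<le> 1"
      using assms(4,8,9) by (cases "l v = 0") (force simp: w_def)+
  qed (rule w_nonneg)
  have cover: "vertex_cover V E C"
    unfolding vertex_cover_def
  proof (intro conjI ballI notI)
    fix e assume e: "e \<in> E" and disj: "C \<inter> e = {}"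
    from assms(1) e have sub: "e \<subseteq> V" and "e \<noteq> {}"
      by (auto simp: hypergraph_def)
    then obtain v where v: "v \<in> e" by blast
    have zero: "l x = 0" if "x \<in> e" for x
      using that disj sub by (auto simp: C_eq)
    \<comment> \<open>The node \<open>v\<close> rules out an empty image, on which
      \<open>Max\<close> would be unspecified.\<close>
    then have "l ` e = {0}" using v by force
    then have "w e = 1" by (simp add: w_def level_weight_def edge_level_def)
    moreover have "w e \<le> node_weight E w v"
      unfolding node_weight_def using fin e v w_nonneg by (intro member_le_sum) auto
    moreover have "node_weight E w v \<le> 1 / \<beta>\<^sup>2"
      using assms(9) v sub zero by (auto simp: w_def)
    ultimately show False using assms(4) by simp
  qed (auto simp: C_def)
  have "real (card C) / (\<alpha> * \<beta>\<^sup>2) = (\<Sum>v\<in>C. 1 / (\<alpha> * \<beta>\<^sup>2))" by simp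
  also have "\<dots> \<le> (\<Sum>v\<in>C. node_weight E w v)"
    \<comment> \<open>The strict bound is weakened because \<open>C\<close> may be empty, and then
      both sums are 0.\<close>
    using assms(8) by (intro sum_mono) (auto simp: C_eq w_def less_imp_le)
  also have "\<dots> = (\<Sum>e\<in>E. real (card (C \<inter> e)) * w e)"
    using fin by (simp add: sum_node_weight)
  also have "\<dots> \<le> (\<Sum>e\<in>E. real f * w e)"
  proof (intro sum_mono mult_right_mono w_nonneg)
    fix e assume e: "e \<in> E"
    then have "finite e" using assms(1) fin by (auto simp: hypergraph_def finite_subset)
    then have "card (C \<inter> e) \<le> card e" by (intro card_mono) auto
    then show "real (card (C \<inter> e)) \<le> real f" using assms(3) e by force
  qed
  also have "\<dots> = real f * matching_size E w"
    by (simp add: matching_size_def sum_distrib_left)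
  finally have main: "real (card C) \<le> real f * \<alpha> * \<beta>\<^sup>2 * matching_size E w"
    using c_pos by (simp add: field_simps)
  obtain w' where w': "max_fractional_matching V E w'"
    using ex_max_fractional_matching[OF assms(1)] .
  \<comment> \<open>Weak duality serves twice: here for the optimal matching \<open>w'\<close>
    against the cover \<open>C\<close>, and below for the given weights \<open>w\<close> against the
    optimal cover \<open>C'\<close>.\<close>
  have "matching_size E w' \<le> real (card C)"
    using w' cover assms(1) matching_size_le_card_vertex_cover
    by (auto simp: max_fractional_matching_def)
  with main have le: "matching_size E w' \<le> real f * \<alpha> * \<beta>\<^sup>2 * matching_size E w"
    by linarith
  have "1 / (real f * \<alpha> * \<beta>\<^sup>2) * matching_size E w' \<le> matching_size E w"
  proof (cases "f = 0")
    case True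
    \<comment> \<open>For \<open>f = 0\<close> the factor is 1 / 0, which is 0 in HOL, so only
      nonnegativity of the size of \<open>w\<close> remains.\<close>
    then show ?thesis by (simp add: matching_size_def sum_nonneg w_nonneg)
  next
    case False
    then have "real f * \<alpha> * \<beta>\<^sup>2 > 0" using c_pos by (simp add: mult.assoc)
    then show ?thesis using le by (simp add: pos_divide_le_eq mult.commute)
  qed
  moreover obtain C' where C': "min_vertex_cover V E C'"
    using ex_min_vertex_cover[OF cover] .
  have "real (card C) \<le> real f * \<alpha> * \<beta>\<^sup>2 * real (card C')"
  proof -
    have "matching_size E w \<le> real (card C')"
      using C' assms(1) matching matching_size_le_card_vertex_cover
      by (auto simp: min_vertex_cover_def)
    then have "real f * \<alpha> * \<beta>\<^sup>2 * matching_size E w \<le> real f * \<alpha> * \<beta>\<^sup>2 * real (card C')"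
      using c_pos by (intro mult_left_mono) (auto simp: mult.assoc)
    with main show ?thesis by linarith
  qed
  ultimately show ?thesis
    using matching w' cover C'
    unfolding approx_max_fractional_matching_def approx_min_vertex_cover_def C_def w_def
    by blast
qed

end
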